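(* Let $X$ be a real normed linear space, $\Omega\subseteq X$ a nonempty closed set, $v\in X$ nonzero, and $T(x):=\inf\{t\ge 0\mid x+tv\in\Omega\}$. For $\bar x\in\Omega$, $$\partial^\infty T(\bar x)=\{v\}^+\cap N(\bar x;\Omega),$$ where $\partial^\infty$ is the singular subdifferential and $N$ is the limiting (Mordukhovich) normal cone.
   Context: $T$ takes values in $[0,\infty]$ with $\inf\emptyset=\infty$; $X^*$ is the topological dual of $X$; $\{v\}^+:=\{x^*\in X^*\mid\langle x^*,v\rangle\ge0\}$. The Fréchet normal cone $\widehat N(y;\Omega)$ at $y\in\Omega$ is the set of $x^*\in X^*$ such that for every $\varepsilon>0$ there is $\delta>0$ with $\langle x^*,x-y\rangle\le\varepsilon\|x-y\|$ for all $x\in\Omega$ with $\|x-y\|\le\delta$. The limiting normal cone $N(\bar x;\Omega)$ is the set of $x^*\in X^*$ for which there are sequences $x_k\to\bar x$ with $x_k\in\Omega$, and $x_k^*\in\widehat N(x_k;\Omega)$ with $x_k^*\to x^*$ weak$^*$. For $\psi:X\to(-\infty,\infty]$ and $\psi(\bar x)<\infty$, the Fréchet subdifferential $\widehat\partial\psi(\bar x)$ is the set of $x^*\in X^*$ such that for every $\varepsilon>0$ there is $\delta>0$ with $\langle x^*,x-\bar x\rangle\le\psi(x)-\psi(\bar x)+\varepsilon\|x-\bar x\|$ whenever $\|x-\bar x\|\le\delta$. The singular subdifferential $\partial^\infty\psi(\bar x)$ is the set of $x^*\in X^*$ for which there are sequences $\lambda_k\to0$ with $\lambda_k>0$, $x_k\to\bar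 x$ with $\psi(x_k)\to\psi(\bar x)$, and $x_k^*\in\widehat\partial\psi(x_k)$ with $\lambda_kx_k^*\to x^*$ weak$^*$. *)

theory Defs
  imports "HOL-Analysis.Analysis"
begin

text \<open>The topological dual of \<open>'a\<close> is the type \<open>'a \<Rightarrow>\<^sub>L real\<close> of bounded linear functionals.
  Functions into \<open>(-\<infinity>, \<infinity>]\<close> or \<open>[0, \<infinity>]\<close> are rendered with values in \<^typ>\<open>ereal\<close>.\<close>

text \<open>Weak* convergence of a sequence in the dual, i.e. pointwise convergence; lemma
  \<open>weak_star_tendsto_iff_limitin\<close> relates it to the topology generated by the evaluation maps
  (the strong operator topology, for functionals).\<close>

definition weak_star_tendsto ::
    "(nat \<Rightarrow> ('a::real_normed_vector \<Rightarrow>\<^sub>L real)) \<Rightarrow> ('a \<Rightarrow>\<^sub>L real) \<Rightarrow> bool" where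
  "weak_star_tendsto F f \<longleftrightarrow>
     (\<forall>x. (\<lambda>k. blinfun_apply (F k) x) \<longlonglongrightarrow> blinfun_apply f x)"

lemma weak_star_tendsto_iff_limitin:
  "weak_star_tendsto F f \<longleftrightarrow> limitin strong_operator_topology F f sequentially"
proof -
  have "limitin strong_operator_topology F f sequentially \<longleftrightarrow>
      limitin euclidean (\<lambda>k. blinfun_apply (F k)) (blinfun_apply f) sequentially"
    unfolding limitin_def strong_operator_topology_def topspace_pullback_topology
      openin_pullback_topology
    by auto
  also have "\<dots> \<longleftrightarrow> weak_star_tendsto F f"
    unfolding weak_star_tendsto_def euclidean_product_topology [symmetric]
      limitin_componentwise
    by simp
  finally show ?thesis by simp
qed

text \<open>The Frechet normal cone is empty at points outside the set, and both subdifferentials are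
  empty at points where the function is not finite; the mathematical definitions leave these
  cases undefined.\<close>

definition frechet_normal_cone ::
    "'a::real_normed_vector \<Rightarrow> 'a set \<Rightarrow> ('a \<Rightarrow>\<^sub>L real) set" where
  "frechet_normal_cone y \<Omega> =
     {f. y \<in> \<Omega> \<and>
         (\<forall>\<epsilon>>0. \<exists>\<delta>>0. \<forall>x\<in>\<Omega>. norm (x - y) \<le> \<delta> \<longrightarrow>
            blinfun_apply f (x - y) \<le> \<epsilon> * norm (x - y))}"

definition limiting_normal_cone ::
    "'a::real_normed_vector \<Rightarrow> 'a set \<Rightarrow> ('a \<Rightarrow>\<^sub>L real) set" where
  "limiting_normal_cone xbar \<Omega> =
     {f. \<exists>x F. (\<forall>k. x k \<in> \<Omega>) \<and> x \<longlonglongrightarrow> xbar \<and>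
               (\<forall>k. F k \<in> frechet_normal_cone (x k) \<Omega>) \<and> weak_star_tendsto F f}"

definition frechet_subdifferential ::
    "('a::real_normed_vector \<Rightarrow> ereal) \<Rightarrow> 'a \<Rightarrow> ('a \<Rightarrow>\<^sub>L real) set" where
  "frechet_subdifferential \<psi> xbar =
     {f. \<bar>\<psi> xbar\<bar> \<noteq> \<infinity> \<and>
         (\<forall>\<epsilon>>0. \<exists>\<delta>>0. \<forall>x. norm (x - xbar) \<le> \<delta> \<longrightarrow>
            ereal (blinfun_apply f (x - xbar)) \<le> \<psi> x - \<psi> xbar + ereal (\<epsilon> * norm (x - xbar)))}"

definition singular_subdifferential ::
    "('a::real_normed_vector \<Rightarrow> ereal) \<Rightarrow> 'a \<Rightarrow> ('a \<Rightarrow>\<^sub>L real) set" where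
  "singular_subdifferential \<psi> xbar =
     {f. \<bar>\<psi> xbar\<bar> \<noteq> \<infinity> \<and>
         (\<exists>\<mu> x F. (\<forall>k. 0 < \<mu> k) \<and> \<mu> \<longlonglongrightarrow> (0::real) \<and>
                 x \<longlonglongrightarrow> xbar \<and> (\<lambda>k. \<psi> (x k)) \<longlonglongrightarrow> \<psi> xbar \<and>
                 (\<forall>k. F k \<in> frechet_subdifferential \<psi> (x k)) \<and>
                 weak_star_tendsto (\<lambda>k. \<mu> k *\<^sub>R F k) f)}"

text \<open>In \<^typ>\<open>ereal\<close> the infimum of the empty set is \<open>\<infinity>\<close>.\<close>

definition min_time :: "'a::real_normed_vector \<Rightarrow> 'a set \<Rightarrow> 'a \<Rightarrow> ereal" where
  "min_time v \<Omega> x = (INF t \<in> {t::real. 0 \<le> t \<and> x + t *\<^sub>R v \<in> \<Omega>}. ereal t)"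

definition nonneg_dual_halfspace :: "'a::real_normed_vector \<Rightarrow> ('a \<Rightarrow>\<^sub>L real) set" where
  "nonneg_dual_halfspace v = {f. 0 \<le> blinfun_apply f v}"

end

theory Submission
  imports Defs
begin

text \<open>A Frechet subgradient \<open>f\<close> of \<open>T\<close> at \<open>x\<close> is a Frechet normal to \<open>\<Omega>\<close> at the projection
  \<open>x + T x v\<close>, and satisfies \<open>f v \<ge> -1\<close> because \<open>T\<close> grows at most with slope one along \<open>-v\<close>.
  Conversely, at a point of \<open>\<Omega>\<close> every Frechet normal with \<open>f v \<ge> -1\<close> is a Frechet subgradient.
  Scaling by \<open>\<mu>\<^sub>k \<rightarrow> 0\<close> relaxes the constraint to \<open>f v \<ge> 0\<close> in the limit; in the other direction
  normals \<open>f\<^sub>k \<rightarrow> f\<close> with \<open>f v \<ge> 0\<close> become subgradients after division by some \<open>\<mu>\<^sub>k \<rightarrow> 0\<close> with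
  \<open>\<mu>\<^sub>k \<ge> - f\<^sub>k v\<close>.\<close>

text \<open>Quantifying over real upper bounds \<open>s\<close> of \<open>\<psi> z\<close> turns the
  extended-real inequality into a real one: where \<open>\<psi> z\<close> is infinite there is no
  such \<open>s\<close>, and for \<open>min_time\<close> every admissible travel time supplies
  one.\<close>

lemma frechet_subdifferential_iff_epigraph:
  fixes \<psi> :: "'a::real_normed_vector \<Rightarrow> ereal"
  assumes "\<psi> x = ereal t"
  shows "f \<in> frechet_subdifferential \<psi> x \<longleftrightarrow>
    (\<forall>\<epsilon>>0. \<exists>\<delta>>0. \<forall>z s. norm (z - x) \<le> \<delta> \<longrightarrow> \<psi> z \<le> ereal s \<longrightarrow>
       blinfun_apply f (z - x) \<le> s - t + \<epsilon> * norm (z - x))"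
proof -
  have *: "ereal a \<le> \<psi> z - ereal t + ereal e \<longleftrightarrow> (\<forall>s. \<psi> z \<le> ereal s \<longrightarrow> a \<le> s - t + e)"
    for a e z
  proof (cases "\<psi> z")
    case MInf
    \<comment> \<open>At value minus infinity both sides fail: every real \<open>s\<close> is an
      upper bound, and this one makes the right-hand side equal to \<open>a - 1\<close>.\<close>
    have "\<not> a \<le> (a + t - e - 1) - t + e" by simp
    then have "\<exists>s. \<not> a \<le> s - t + e" by blast
    with MInf show ?thesis by simp
  qed (auto intro: order_trans)
  show ?thesis
    unfolding frechet_subdifferential_def mem_Collect_eq assms * by auto
qed

lemma frechet_normal_cone_scaleR:
  assumes f: "f \<in> frechet_normal_cone y \<Omega>" and c: "0 < c"
  shows "c *\<^sub>R f \<in> frechet_normal_cone y \<Omega>"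
proof -
  have "\<exists>\<delta>>0. \<forall>x\<in>\<Omega>. norm (x - y) \<le> \<delta> \<longrightarrow>
      blinfun_apply (c *\<^sub>R f) (x - y) \<le> \<epsilon> * norm (x - y)" if "\<epsilon> > 0" for \<epsilon>
  proof -
    have "\<epsilon> / c > 0" using that c by simp
    then obtain \<delta> where "\<delta> > 0"
      and \<delta>: "\<And>x. x \<in> \<Omega> \<Longrightarrow> norm (x - y) \<le> \<delta> \<Longrightarrow>
        blinfun_apply f (x - y) \<le> \<epsilon> / c * norm (x - y)"
      using f unfolding frechet_normal_cone_def by blast
    have "blinfun_apply (c *\<^sub>R f) (x - y) \<le> \<epsilon> * norm (x - y)"
      if "x \<in> \<Omega>" "norm (x - y) \<le> \<delta>" for x
      using mult_left_mono [OF \<delta> [OF that], of c] c by (simp add: scaleR_blinfun.rep_eq)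
    with \<open>\<delta> > 0\<close> show ?thesis by blast
  qed
  with f show ?thesis unfolding frechet_normal_cone_def by blast
qed

lemma min_time_le:
  assumes "0 \<le> t" "x + t *\<^sub>R v \<in> \<Omega>"
  shows "min_time v \<Omega> x \<le> ereal t"
  unfolding min_time_def using assms by (intro INF_lower) auto

lemma min_time_nonneg: "0 \<le> min_time v \<Omega> x"
  unfolding min_time_def by (intro INF_greatest) auto

lemma min_time_eq_0:
  assumes "x \<in> \<Omega>"
  shows "min_time v \<Omega> x = 0"
  using min_time_le [of 0 x v \<Omega>] min_time_nonneg [of v \<Omega> x] assms
  by (simp add: zero_ereal_def)

text \<open>The admissible times are the part in \<open>{0..}\<close> of the preimage of
  \<open>\<Omega>\<close> under a continuous affine map. This set is closed and bounded below, and
  nonempty because its infimum is finite, so it contains its infimum.\<close>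

lemma min_time_attained:
  assumes "closed \<Omega>" and "min_time v \<Omega> x < \<infinity>"
  obtains t where "0 \<le> t" "min_time v \<Omega> x = ereal t" "x + t *\<^sub>R v \<in> \<Omega>"
proof -
  define S where "S = {t::real. 0 \<le> t \<and> x + t *\<^sub>R v \<in> \<Omega>}"
  have "S = {0..} \<inter> (\<lambda>t. x + t *\<^sub>R v) -` \<Omega>"
    unfolding S_def by auto
  then have "closed S"
    using assms(1) by (auto intro!: closed_Int closed_vimage continuous_intros)
  moreover have "S \<noteq> {}"
    using assms(2) unfolding min_time_def S_def [symmetric] by (auto simp: top_ereal_def)
  moreover have bdd: "bdd_below S"
    unfolding S_def by (intro bdd_belowI [of _ 0]) auto
  ultimately have "Inf S \<in> S"
    by (simp add: closed_contains_Inf)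
  moreover have "min_time v \<Omega> x = ereal (Inf S)"
    unfolding min_time_def S_def [symmetric]
    using \<open>Inf S \<in> S\<close> bdd by (intro antisym INF_lower INF_greatest) (auto intro: cInf_lower)
  ultimately show thesis
    using that unfolding S_def by auto
qed

text \<open>For \<open>z\<close> in \<open>\<Omega>\<close> the shifted point \<open>z - t v\<close>
  reaches \<open>\<Omega>\<close> within time \<open>t\<close>, which is the value at
  \<open>x\<close>. Testing the subgradient inequality there cancels the time terms and leaves the
  normal cone inequality.\<close>

lemma frechet_subdifferential_min_time_normal:
  assumes f: "f \<in> frechet_subdifferential (min_time v \<Omega>) x"
    and t: "0 \<le> t" "min_time v \<Omega> x = ereal t" "x + t *\<^sub>R v \<in> \<Omega>"
  shows "f \<in> frechet_normal_cone (x + t *\<^sub>R v) \<Omega>"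
proof -
  have "\<exists>\<delta>>0. \<forall>z\<in>\<Omega>. norm (z - (x + t *\<^sub>R v)) \<le> \<delta> \<longrightarrow>
      blinfun_apply f (z - (x + t *\<^sub>R v)) \<le> \<epsilon> * norm (z - (x + t *\<^sub>R v))" if \<epsilon>: "\<epsilon> > 0" for \<epsilon>
  proof -
    obtain \<delta> where "\<delta> > 0"
      and \<delta>: "\<And>z s. norm (z - x) \<le> \<delta> \<Longrightarrow> min_time v \<Omega> z \<le> ereal s \<Longrightarrow>
        blinfun_apply f (z - x) \<le> s - t + \<epsilon> * norm (z - x)"
      using f \<epsilon> unfolding frechet_subdifferential_iff_epigraph [of "min_time v \<Omega>", OF t(2)]
      by blast
    have "blinfun_apply f (z - (x + t *\<^sub>R v)) \<le> \<epsilon> * norm (z - (x + t *\<^sub>R v))"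
      if "z \<in> \<Omega>" "norm (z - (x + t *\<^sub>R v)) \<le> \<delta>" for z
    proof -
      have eq: "z - t *\<^sub>R v - x = z - (x + t *\<^sub>R v)" by simp
      have "min_time v \<Omega> (z - t *\<^sub>R v) \<le> ereal t"
        using that t(1) by (intro min_time_le) auto
      then show ?thesis
        using \<delta> [of "z - t *\<^sub>R v" t] that unfolding eq by simp
    qed
    with \<open>\<delta> > 0\<close> show ?thesis by blast
  qed
  with t(3) show ?thesis unfolding frechet_normal_cone_def by blast
qed

lemma frechet_subdifferential_min_time_apply_ge:
  assumes f: "f \<in> frechet_subdifferential (min_time v \<Omega>) x"
    and t: "0 \<le> t" "min_time v \<Omega> x = ereal t" "x + t *\<^sub>R v \<in> \<Omega>"
  shows "-1 \<le> blinfun_apply f v"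
proof (cases "v = 0")
  case True
  then show ?thesis by (simp add: blinfun.zero_right)
next
  case False
  have "- blinfun_apply f v \<le> 1 + e" if "e > 0" for e
  proof -
    \<comment> \<open>With this tolerance the error for a step of length \<open>r\<close> along
      \<open>-v\<close> is exactly \<open>r * e\<close>, so that \<open>r\<close> can be
      cancelled.\<close>
    have "e / norm v > 0" using that False by simp
    then obtain \<delta> where "\<delta> > 0"
      and \<delta>: "\<And>z s. norm (z - x) \<le> \<delta> \<Longrightarrow> min_time v \<Omega> z \<le> ereal s \<Longrightarrow>
        blinfun_apply f (z - x) \<le> s - t + e / norm v * norm (z - x)"
      using f unfolding frechet_subdifferential_iff_epigraph [of "min_time v \<Omega>", OF t(2)]
      by blast
    define r where "r = \<delta> / norm v"
    have r: "r > 0" "r * norm v = \<delta>"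
      using \<open>\<delta> > 0\<close> False by (auto simp: r_def)
    have "min_time v \<Omega> (x - r *\<^sub>R v) \<le> ereal (t + r)"
      using t r by (intro min_time_le) (auto simp: scaleR_add_left)
    then have "blinfun_apply f (- (r *\<^sub>R v)) \<le> r + e / norm v * (r * norm v)"
      using \<delta> [of "x - r *\<^sub>R v" "t + r"] r by simp
    then have "r * (- blinfun_apply f v) \<le> r * (1 + e)"
      using False by (simp add: blinfun.minus_right blinfun.scaleR_right algebra_simps)
    then show ?thesis
      using r(1) by (simp only: mult_le_cancel_left_pos)
  qed
  then have "- blinfun_apply f v \<le> 1" by (rule field_le_epsilon)
  then show ?thesis by simp
qed

lemma frechet_normal_in_frechet_subdifferential_min_time:
  assumes cl: "closed \<Omega>"
    and f: "f \<in> frechet_normal_cone y \<Omega>" and fv: "-1 \<le> blinfun_apply f v"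
  shows "f \<in> frechet_subdifferential (min_time v \<Omega>) y"
proof -
  have "y \<in> \<Omega>" using f by (simp add: frechet_normal_cone_def)
  then have y0: "min_time v \<Omega> y = ereal 0"
    by (simp add: min_time_eq_0 zero_ereal_def)
  \<comment> \<open>If the travel time \<open>t\<close> is below
    \<open>norm f * norm (z - y)\<close>, then \<open>z + t v\<close> lies within
    \<open>C * norm (z - y)\<close> of \<open>y\<close>. Hence the radius
    \<open>\<delta> / C\<close> and the tolerance \<open>\<epsilon> / C\<close> below; the summand 1
    also keeps \<open>C\<close> positive.\<close>
  define C where "C = 1 + norm f * norm v"
  have C: "C > 0" unfolding C_def by (intro add_pos_nonneg) auto
  have "\<exists>\<delta>>0. \<forall>z s. norm (z - y) \<le> \<delta> \<longrightarrow> min_time v \<Omega> z \<le> ereal s \<longrightarrow>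
      blinfun_apply f (z - y) \<le> s - 0 + \<epsilon> * norm (z - y)" if "\<epsilon> > 0" for \<epsilon>
  proof -
    have "\<epsilon> / C > 0" using that C by simp
    then obtain \<delta> where "\<delta> > 0"
      and \<delta>: "\<And>x. x \<in> \<Omega> \<Longrightarrow> norm (x - y) \<le> \<delta> \<Longrightarrow>
        blinfun_apply f (x - y) \<le> \<epsilon> / C * norm (x - y)"
      using f unfolding frechet_normal_cone_def by blast
    have "blinfun_apply f (z - y) \<le> s - 0 + \<epsilon> * norm (z - y)"
      if z: "norm (z - y) \<le> \<delta> / C" and s: "min_time v \<Omega> z \<le> ereal s" for z s
    proof -
      have "min_time v \<Omega> z < \<infinity>" using s by auto
      with cl obtain t where t: "0 \<le> t" "min_time v \<Omega> z = ereal t" "z + t *\<^sub>R v \<in> \<Omega>"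
        by (rule min_time_attained)
      have "blinfun_apply f (z - y) \<le> t + \<epsilon> * norm (z - y)"
      \<comment> \<open>Long travel times dominate \<open>f\<close> by its operator norm; short ones keep
        \<open>z + t v\<close> within a multiple of the distance of \<open>z\<close> from \<open>y\<close>.\<close>
      proof (cases "norm f * norm (z - y) \<le> t")
        case True
        have "blinfun_apply f (z - y) \<le> norm f * norm (z - y)"
          using norm_blinfun [of f "z - y"] by simp
        also have "\<dots> \<le> t + \<epsilon> * norm (z - y)"
          using True \<open>\<epsilon> > 0\<close> by (simp add: add_increasing2)
        finally show ?thesis .
      next
        case False
        have eq: "z + t *\<^sub>R v - y = (z - y) + t *\<^sub>R v" by simp
        have "norm (z + t *\<^sub>R v - y) \<le> norm (z - y) + t * norm v"
          unfolding eq using norm_triangle_ineq [of "z - y" "t *\<^sub>R v"] t(1) by simp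
        also have "\<dots> \<le> norm (z - y) + norm f * norm (z - y) * norm v"
          using False by (intro add_left_mono mult_right_mono) auto
        also have "\<dots> = C * norm (z - y)" by (simp add: C_def algebra_simps)
        finally have le: "norm (z + t *\<^sub>R v - y) \<le> C * norm (z - y)" .
        also have "\<dots> \<le> \<delta>" using z C by (simp add: field_simps)
        finally have "blinfun_apply f (z + t *\<^sub>R v - y) \<le> \<epsilon> / C * norm (z + t *\<^sub>R v - y)"
          by (rule \<delta> [OF t(3)])
        also have "\<dots> \<le> \<epsilon> / C * (C * norm (z - y))"
          using le \<open>\<epsilon> / C > 0\<close> by (intro mult_left_mono) auto
        also have "\<dots> = \<epsilon> * norm (z - y)" using C by simp
        finally have "blinfun_apply f (z - y) + t * blinfun_apply f v \<le> \<epsilon> * norm (z - y)"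
          unfolding eq by (simp add: blinfun.add_right blinfun.scaleR_right)
        \<comment> \<open>The bound on \<open>f v\<close> enters here: passing from
          \<open>z + t v\<close> back to \<open>z\<close> costs at most \<open>t\<close>, the time
          itself.\<close>
        moreover have "t * (-1) \<le> t * blinfun_apply f v"
          using t(1) fv by (intro mult_left_mono)
        ultimately show ?thesis by simp
      qed
      with s t(2) show ?thesis by simp
    qed
    with \<open>\<delta> > 0\<close> C show ?thesis by (intro exI [of _ "\<delta> / C"]) auto
  qed
  then show ?thesis
    unfolding frechet_subdifferential_iff_epigraph [of "min_time v \<Omega>", OF y0] by blast
qed

lemma singular_subdifferential_min_time_subset:
  assumes cl: "closed \<Omega>" and xbar: "xbar \<in> \<Omega>"
  shows "singular_subdifferential (min_time v \<Omega>) xbar \<subseteq>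
           nonneg_dual_halfspace v \<inter> limiting_normal_cone xbar \<Omega>"
proof
  fix f assume "f \<in> singular_subdifferential (min_time v \<Omega>) xbar"
  then obtain \<mu> x F where \<mu>: "\<And>k. 0 < \<mu> k" "\<mu> \<longlonglongrightarrow> (0::real)" and x: "x \<longlonglongrightarrow> xbar"
    and T: "(\<lambda>k. min_time v \<Omega> (x k)) \<longlonglongrightarrow> min_time v \<Omega> xbar"
    and F: "\<And>k. F k \<in> frechet_subdifferential (min_time v \<Omega>) (x k)"
    and w: "weak_star_tendsto (\<lambda>k. \<mu> k *\<^sub>R F k) f"
    unfolding singular_subdifferential_def by blast
  have "min_time v \<Omega> (x k) < \<infinity>" for k
    using F [of k] unfolding frechet_subdifferential_def by auto
  then have "\<exists>t\<ge>0. min_time v \<Omega> (x k) = ereal t \<and> x k + t *\<^sub>R v \<in> \<Omega>" for k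
    using min_time_attained [OF cl] by metis
  then obtain t where t: "\<And>k. 0 \<le> t k" "\<And>k. min_time v \<Omega> (x k) = ereal (t k)"
      "\<And>k. x k + t k *\<^sub>R v \<in> \<Omega>"
    by metis
  \<comment> \<open>Convergence of the function values, required in the singular subdifferential,
    makes the travel times vanish, so the projections converge to \<open>xbar\<close> together with
    the \<open>x k\<close>.\<close>
  have "t \<longlonglongrightarrow> 0"
    using T unfolding t(2) min_time_eq_0 [OF xbar] zero_ereal_def by simp
  with x have y: "(\<lambda>k. x k + t k *\<^sub>R v) \<longlonglongrightarrow> xbar"
    by (auto intro!: tendsto_eq_intros)
  have "\<mu> k *\<^sub>R F k \<in> frechet_normal_cone (x k + t k *\<^sub>R v) \<Omega>" for k
    using frechet_subdifferential_min_time_normal [OF F t] \<mu>(1)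
    by (intro frechet_normal_cone_scaleR)
  then have "f \<in> limiting_normal_cone xbar \<Omega>"
    using t(3) y w unfolding limiting_normal_cone_def
    by (intro CollectI exI [of _ "\<lambda>k. x k + t k *\<^sub>R v"] exI [of _ "\<lambda>k. \<mu> k *\<^sub>R F k"]) auto
  moreover have "0 \<le> blinfun_apply f v"
  proof (rule LIMSEQ_le)
    show "(\<lambda>k. - \<mu> k) \<longlonglongrightarrow> 0" using tendsto_minus [OF \<mu>(2)] by simp
    show "(\<lambda>k. blinfun_apply (\<mu> k *\<^sub>R F k) v) \<longlonglongrightarrow> blinfun_apply f v"
      using w unfolding weak_star_tendsto_def by blast
    have "- \<mu> k \<le> blinfun_apply (\<mu> k *\<^sub>R F k) v" for k
      using mult_left_mono [OF frechet_subdifferential_min_time_apply_ge [OF F t], of "\<mu> k" k]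
        \<mu>(1) [of k]
      by (simp add: scaleR_blinfun.rep_eq)
    then show "\<exists>N. \<forall>k\<ge>N. - \<mu> k \<le> blinfun_apply (\<mu> k *\<^sub>R F k) v" by blast
  qed
  ultimately show "f \<in> nonneg_dual_halfspace v \<inter> limiting_normal_cone xbar \<Omega>"
    by (simp add: nonneg_dual_halfspace_def)
qed

lemma singular_subdifferential_min_time_supset:
  assumes cl: "closed \<Omega>" and xbar: "xbar \<in> \<Omega>"
  shows "nonneg_dual_halfspace v \<inter> limiting_normal_cone xbar \<Omega> \<subseteq>
           singular_subdifferential (min_time v \<Omega>) xbar"
proof
  fix f assume "f \<in> nonneg_dual_halfspace v \<inter> limiting_normal_cone xbar \<Omega>"
  then obtain y G where fv: "0 \<le> blinfun_apply f v"
    and y: "\<And>k. y k \<in> \<Omega>" "y \<longlonglongrightarrow> xbar"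
    and G: "\<And>k. G k \<in> frechet_normal_cone (y k) \<Omega>" and w: "weak_star_tendsto G f"
    unfolding nonneg_dual_halfspace_def limiting_normal_cone_def by blast
  \<comment> \<open>The maximum secures \<open>\<mu> k \<ge> - G k v\<close> and tends to 0 because
    the limit functional is nonnegative at \<open>v\<close>; the vanishing second term keeps
    \<open>\<mu> k\<close> positive where the maximum is 0.\<close>
  define \<mu> where "\<mu> k = max (- blinfun_apply (G k) v) 0 + inverse (real (Suc k))" for k
  have \<mu>_pos: "0 < \<mu> k" for k
    unfolding \<mu>_def by (intro add_nonneg_pos) auto
  have "(\<lambda>k. blinfun_apply (G k) v) \<longlonglongrightarrow> blinfun_apply f v"
    using w unfolding weak_star_tendsto_def by blast
  then have "\<mu> \<longlonglongrightarrow> max (- blinfun_apply f v) 0 + 0"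
    unfolding \<mu>_def by (intro tendsto_add tendsto_max tendsto_minus tendsto_const
        LIMSEQ_inverse_real_of_nat)
  then have \<mu>_lim: "\<mu> \<longlonglongrightarrow> 0" using fv by simp
  have "inverse (\<mu> k) *\<^sub>R G k \<in> frechet_subdifferential (min_time v \<Omega>) (y k)" for k
  proof (rule frechet_normal_in_frechet_subdifferential_min_time [OF cl])
    show "inverse (\<mu> k) *\<^sub>R G k \<in> frechet_normal_cone (y k) \<Omega>"
      using G \<mu>_pos by (intro frechet_normal_cone_scaleR) auto
    have "0 < inverse (real (Suc k))" by simp
    then have "- \<mu> k \<le> blinfun_apply (G k) v" unfolding \<mu>_def by linarith
    then show "-1 \<le> blinfun_apply (inverse (\<mu> k) *\<^sub>R G k) v"
      using \<mu>_pos [of k] by (simp add: scaleR_blinfun.rep_eq field_simps)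
  qed
  moreover have "(\<lambda>k. \<mu> k *\<^sub>R (inverse (\<mu> k) *\<^sub>R G k)) = G"
    using \<mu>_pos by (simp add: less_imp_neq [symmetric])
  \<comment> \<open>The base points stay in \<open>\<Omega>\<close>, so this sequence is constantly
    0.\<close>
  moreover have "(\<lambda>k. min_time v \<Omega> (y k)) \<longlonglongrightarrow> min_time v \<Omega> xbar"
    using y(1) xbar by (simp add: min_time_eq_0)
  moreover have "\<bar>min_time v \<Omega> xbar\<bar> \<noteq> \<infinity>"
    using xbar by (simp add: min_time_eq_0)
  ultimately show "f \<in> singular_subdifferential (min_time v \<Omega>) xbar"
    unfolding singular_subdifferential_def using \<mu>_pos \<mu>_lim y(2) w
    by (intro CollectI conjI exI [of _ \<mu>] exI [of _ y] exI [of _ "\<lambda>k. inverse (\<mu> k) *\<^sub>R G k"])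
      auto
qed

theorem theorem3p20:
  fixes \<Omega> :: "'a::real_normed_vector set" and v xbar :: 'a
  assumes "\<Omega> \<noteq> {}" and "closed \<Omega>" and "v \<noteq> 0" and "xbar \<in> \<Omega>"
  shows "singular_subdifferential (min_time v \<Omega>) xbar =
           nonneg_dual_halfspace v \<inter> limiting_normal_cone xbar \<Omega>"
  using singular_subdifferential_min_time_subset [OF assms(2,4)]
    singular_subdifferential_min_time_supset [OF assms(2,4)]
  by (rule antisym)

end
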